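(* Let $p\in\mathbb{N}^*$ and $r\in\mathbb{K}^*$. For any $a,c\in\ell(\mathbb{K}^*;p,r)$ and $b\in\ell(\mathbb{K};p,r)$, the difference equation $$a(k)z(k+1)-b(k)z(k)+c(k-1)z(k-1)=0,\qquad k\in\mathbb{Z},$$ has non-null quasi-periodic solutions $z\in\ell(\mathbb{K};p,\hat r)$ with period $p$ and ratio $\hat r\in\mathbb{K}^*$ if and only if $$\hat r\,a^{\pi_p}+(r\hat r)^{-1}c^{\pi_p}=\sum_{j=0}^{\lfloor p/2\rfloor}(-1)^j\sum_{\alpha\in\Lambda_p^j}r^{-\alpha_{p-1}}\,a^{\alpha}\,b^{\bar\alpha}\,c^{\alpha}.$$
   Context: $\mathbb{K}$ denotes either $\mathbb{R}$ or $\mathbb{C}$, $\mathbb{K}^*=\mathbb{K}\setminus\{0\}$, $\mathbb{N}^*=\{1,2,\dots\}$. $\ell(\mathbb{K})$ is the space of sequences $z:\mathbb{Z}\to\mathbb{K}$; $\ell(\mathbb{K};p,r)$ is the set of $z\in\ell(\mathbb{K})$ with $z(k+p)=r\,z(k)$ for all $k\in\mathbb{Z}$ (quasi-periodic with period $p$ and ratio $r$); $\ell(\mathbb{K}^*;p,r)$ is the subset of those that never vanish. Multi-indices. A binary multi-index of order $p$ is $\alpha=(\alpha_0,\dots,\alpha_{p-1})\in\{0,1\}^p$, with $|\alpha|=\sum_{j=0}^{p-1}\alpha_j$; $\pi_p=(1,\dots,1)$. For a sequence $a$, $a^\alpha=\prod_{j=0}^{p-1}a(j)^{\alpha_j}$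 with $0^0=1$ (so $a^{\pi_p}=\prod_{j=0}^{p-1}a(j)$). When $|\alpha|=m$, let $0\le i_1<\dots<i_m\le p-1$ be the indices with $\alpha_{i_1}=\dots=\alpha_{i_m}=1$. Define $\Lambda_p^0=\{(0,\dots,0)\}$; for $p\ge2$, $\Lambda_p^1=\{\alpha\in\{0,1\}^p:|\alpha|=1\}$; for $p\ge4$ and $2\le m\le\lfloor p/2\rfloor$, $\Lambda_p^m$ is the set of $\alpha\in\{0,1\}^p$ with $|\alpha|=m$, $i_{j+1}-i_j\ge2$ for $j=1,\dots,m-1$, and $i_m\le p-2$ when $i_1=0$. For $\alpha\in\Lambda_p^m$ with $m\ge1$, $\bar\alpha\in\{0,1\}^p$ is defined by $\bar\alpha_{i_j}=\bar\alpha_{i_j+1}=0$ for $j=1,\dots,m$ and $\bar\alpha_i=1$ otherwise, where if $i_m=p-1$ the index $i_m+1$ is read as $0$; for $\alpha=(0,\dots,0)$, $\bar\alpha=\pi_p$. *)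

theory Defs
  imports Complex_Main "HOL-Library.FuncSet"
begin

text \<open>
  The scalar field is a type of class \<^class>\<open>real_normed_field\<close>. By Ostrowski's theorem every such field
  is isomorphic to \<open>\<real>\<close> or to \<open>\<complex>\<close>, so a type variable of this class ranges over exactly these two.
\<close>

definition qp_seqs :: "nat \<Rightarrow> 'a::real_normed_field \<Rightarrow> (int \<Rightarrow> 'a) set" where
  "qp_seqs p r = {z. \<forall>k. z (k + int p) = r * z k}"

definition qp_seqs_nz :: "nat \<Rightarrow> 'a::real_normed_field \<Rightarrow> (int \<Rightarrow> 'a) set" where
  "qp_seqs_nz p r = {z \<in> qp_seqs p r. \<forall>k. z k \<noteq> 0}"

definition binary_indices :: "nat \<Rightarrow> (nat \<Rightarrow> nat) set" where
  "binary_indices p = {..<p} \<rightarrow>\<^sub>E {0, 1}"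

definition full_index :: "nat \<Rightarrow> nat \<Rightarrow> nat" where
  "full_index p = (\<lambda>i\<in>{..<p}. 1)"

definition index_order :: "nat \<Rightarrow> (nat \<Rightarrow> nat) \<Rightarrow> nat" where
  "index_order p \<alpha> = (\<Sum>j<p. \<alpha> j)"

definition multi_power :: "nat \<Rightarrow> (int \<Rightarrow> 'a::real_normed_field) \<Rightarrow> (nat \<Rightarrow> nat) \<Rightarrow> 'a" where
  "multi_power p a \<alpha> = (\<Prod>j<p. a (int j) ^ \<alpha> j)"

text \<open>
  The increasing list \<open>[i\<^sub>1, \<dots>, i\<^sub>m]\<close> of the positions of the ones of \<open>\<alpha>\<close>; lists are
  numbered from 0, so \<open>i\<^sub>j\<close> is \<open>ones p \<alpha> ! (j - 1)\<close>.
\<close>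

definition ones :: "nat \<Rightarrow> (nat \<Rightarrow> nat) \<Rightarrow> nat list" where
  "ones p \<alpha> = sorted_list_of_set {i. i < p \<and> \<alpha> i = 1}"

text \<open>
  Only the values with \<open>m \<le> p div 2\<close> are meaningful; thus \<open>p \<ge> 2\<close> if \<open>m = 1\<close>, and \<open>p \<ge> 4\<close> if \<open>m \<ge> 2\<close>.
\<close>

definition Lam :: "nat \<Rightarrow> nat \<Rightarrow> (nat \<Rightarrow> nat) set" where
  "Lam p m =
    (if m = 0 then {\<lambda>i\<in>{..<p}. 0}
     else if m = 1 then {\<alpha> \<in> binary_indices p. index_order p \<alpha> = 1}
     else {\<alpha> \<in> binary_indices p. index_order p \<alpha> = m \<and>
            (\<forall>j. j + 1 < m \<longrightarrow> ones p \<alpha> ! j + 2 \<le> ones p \<alpha> ! (j + 1)) \<and>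
            (ones p \<alpha> ! 0 = 0 \<longrightarrow> ones p \<alpha> ! (m - 1) \<le> p - 2)})"

text \<open>
  The reduction modulo \<open>p\<close> only acts on \<open>i\<^sub>m + 1\<close> when \<open>i\<^sub>m = p - 1\<close>, where it gives 0. For the zero
  multi-index there are no ones, and the value is \<open>full_index p\<close>.
\<close>

definition bar :: "nat \<Rightarrow> (nat \<Rightarrow> nat) \<Rightarrow> nat \<Rightarrow> nat" where
  "bar p \<alpha> = (\<lambda>i\<in>{..<p}. if \<exists>s \<in> set (ones p \<alpha>). i = s \<or> i = (s + 1) mod p then 0 else 1)"

end

theory Submission
  imports Defs
begin

text \<open>
  Put \<open>x n = z (n - 1)\<close>. The equation is a second order recurrence, so a solution is determined by
  \<open>(x 0, x 1)\<close>, and since the coefficients are quasi-periodic with the common ratio \<open>r\<close>, shifting a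
  solution by \<open>p\<close> gives a solution again. Hence \<open>z\<close> has ratio \<open>rh\<close> as soon as it does so at one place,
  \<open>(x p, x (p + 1)) = rh (x 0, x 1)\<close> (\<open>qp_solution_iff_boundary\<close>): the number \<open>rh\<close> has to be an
  eigenvalue of the transfer matrix over one period, which means that a \<open>2 \<times> 2\<close> determinant vanishes.

  Once the denominators are cleared, the entries of the transfer matrix are, up to factors from the ends of
  the period, continuants, that is, determinants of tridiagonal matrices, with diagonal \<open>b\<close> and edge weights
  \<open>a k * c k\<close> (\<open>recurrence_solution_continuant\<close>). Dividing the characteristic equation by \<open>rh\<close> gives
  \<open>rh + determinant / rh = trace\<close>. Multiplied by \<open>a 0 \<cdots> a (p - 1)\<close>, its left-hand side becomes that of the
  claim, because the determinant is the product of the \<open>c (k - 1) / a k\<close> (\<open>continuant_casoratian\<close>), and its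
  right-hand side becomes the difference of a continuant and a multiple of a second one.

  It remains to see that this difference is the sum over multi-indices. A continuant is the signed sum over all
  matchings of a path, an edge \<open>{i, i + 1}\<close> contributing its weight and an unmatched vertex \<open>i\<close> contributing
  \<open>b i\<close> (\<open>continuant_eq_sum_matchings\<close>). The second continuant collects the matchings that use the
  edge \<open>{p - 1, 0}\<close>, so the difference is the same sum over the matchings of the cycle of length \<open>p\<close>
  (\<open>sum_cycle_matchings\<close>). Finally, recording an edge by its first vertex, the multi-indices of \<open>Lam p j\<close>
  are the matchings of the cycle with \<open>j\<close> edges (\<open>Lam_eq_image\<close>), and \<open>bar\<close> marks the unmatched vertices.
  The factor \<open>r\<close> to the power \<open>- \<alpha> (p - 1)\<close> appears because the edge \<open>{p - 1, 0}\<close> carries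
  \<open>a (p - 1) * c (- 1)\<close>, and \<open>c (- 1) = c (p - 1) / r\<close>.
\<close>

section \<open>Quasi-periodic sequences\<close>

lemma qp_seqs_shift:
  assumes "z \<in> qp_seqs p r" and "r \<noteq> 0"
  shows "z (k + q * int p) = r powi q * z k"
proof (induction q rule: int_induct[where k = 0])
  case base
  show ?case by simp
next
  case (step1 i)
  have "z (k + (i + 1) * int p) = z ((k + i * int p) + int p)"
    by (simp add: algebra_simps)
  also have "\<dots> = r * z (k + i * int p)"
    using assms(1) by (simp add: qp_seqs_def)
  finally show ?case
    using step1 assms(2) by (simp add: power_int_add)
next
  case (step2 i)
  have "z (k + i * int p) = z ((k + (i - 1) * int p) + int p)"
    by (simp add: algebra_simps)
  also have "\<dots> = r * z (k + (i - 1) * int p)"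
    using assms(1) by (simp add: qp_seqs_def)
  finally show ?case
    using step2 assms(2) by (simp add: power_int_diff field_simps)
qed

section \<open>Continuants\<close>

text \<open>
  The determinant of the tridiagonal matrix of size \<open>n\<close> with diagonal \<open>b s, \<dots>, b (s + n - 1)\<close> in which the
  product of the two entries next to the diagonal at \<open>(i, i + 1)\<close> is \<open>w i\<close>.
\<close>

fun continuant :: "(nat \<Rightarrow> 'a::comm_ring_1) \<Rightarrow> (nat \<Rightarrow> 'a) \<Rightarrow> nat \<Rightarrow> nat \<Rightarrow> 'a" where
  "continuant b w s 0 = 1"
| "continuant b w s (Suc 0) = b s"
| "continuant b w s (Suc (Suc n)) =
     b (s + Suc n) * continuant b w s (Suc n) - w (s + n) * continuant b w s n"

text \<open>
  The continuant of the vertices \<open>1, \<dots>, n - 1\<close>. The value 0 at \<open>n = 0\<close> is the one that extends the recurrence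
  \<open>inner_continuant_rec\<close> down to \<open>n = 0\<close>, so that this sequence and \<open>continuant b w 0\<close> satisfy the same
  recurrence with initial values \<open>0, 1\<close> and \<open>1, b 0\<close>.
\<close>

definition inner_continuant :: "(nat \<Rightarrow> 'a::comm_ring_1) \<Rightarrow> (nat \<Rightarrow> 'a) \<Rightarrow> nat \<Rightarrow> 'a" where
  "inner_continuant b w n = (case n of 0 \<Rightarrow> 0 | Suc m \<Rightarrow> continuant b w 1 m)"

lemma inner_continuant_simps [simp]:
  "inner_continuant b w 0 = 0"
  "inner_continuant b w (Suc n) = continuant b w 1 n"
  by (simp_all add: inner_continuant_def)

lemma inner_continuant_rec:
  "inner_continuant b w (Suc (Suc n)) =
     b (Suc n) * inner_continuant b w (Suc n) - w n * inner_continuant b w n"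
  by (cases n) simp_all

text \<open>
  The Casoratian of two solutions of a second order recurrence satisfies a first order one: each step
  multiplies it by the coefficient \<open>w n\<close>. It supplies the determinant of the transfer matrix.
\<close>

lemma continuant_casoratian:
  "continuant b w 0 n * inner_continuant b w (Suc n)
     - continuant b w 0 (Suc n) * inner_continuant b w n = (\<Prod>j<n. w j)"
proof (induction n)
  case 0
  show ?case by simp
next
  case (Suc n)
  have "continuant b w 0 (Suc n) * inner_continuant b w (Suc (Suc n))
      - continuant b w 0 (Suc (Suc n)) * inner_continuant b w (Suc n)
      = w n * (continuant b w 0 n * inner_continuant b w (Suc n)
          - continuant b w 0 (Suc n) * inner_continuant b w n)"
    unfolding inner_continuant_rec by (simp add: algebra_simps)
  then show ?case
    using Suc by (simp add: mult.commute)
qed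

text \<open>
  Division by the leading coefficients is avoided by clearing denominators. Multiplying the step from \<open>n\<close> to
  \<open>n + 1\<close> by \<open>a 0 \<cdots> a n\<close> leaves the coefficient \<open>a n * c' (n + 1)\<close> in front of the earlier term, which is
  why these products are the weights of the continuants.
\<close>

lemma recurrence_solution_continuant:
  fixes x :: "nat \<Rightarrow> 'a::comm_ring_1"
  assumes rec: "\<And>n. n < N \<Longrightarrow> a n * x (Suc (Suc n)) = b n * x (Suc n) - c' n * x n"
    and "n \<le> N"
  shows "(\<Prod>j<n. a j) * x (Suc n) =
    continuant b (\<lambda>i. a i * c' (Suc i)) 0 n * x 1
      - c' 0 * inner_continuant b (\<lambda>i. a i * c' (Suc i)) n * x 0"
  using assms(2)
proof (induction n rule: induct_nat_012)
  case 0
  show ?case by simp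
next
  case 1
  then show ?case using rec[of 0] by simp
next
  case (ge2 n)
  let ?w = "\<lambda>i. a i * c' (Suc i)"
  let ?A = "\<lambda>n. \<Prod>j<n. a j"
  have "?A (Suc (Suc n)) * x (Suc (Suc (Suc n)))
      = ?A (Suc n) * (a (Suc n) * x (Suc (Suc (Suc n))))"
    by (simp add: algebra_simps)
  also have "\<dots> = ?A (Suc n) * (b (Suc n) * x (Suc (Suc n)) - c' (Suc n) * x (Suc n))"
    using rec[of "Suc n"] ge2.prems by simp
  also have "\<dots> = b (Suc n) * (?A (Suc n) * x (Suc (Suc n))) - ?w n * (?A n * x (Suc n))"
    by (simp add: algebra_simps)
  also have "?A (Suc n) * x (Suc (Suc n)) =
      continuant b ?w 0 (Suc n) * x 1 - c' 0 * inner_continuant b ?w (Suc n) * x 0"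
    by (rule ge2.IH(2)) (use ge2.prems in simp)
  also have "?A n * x (Suc n) =
      continuant b ?w 0 n * x 1 - c' 0 * inner_continuant b ?w n * x 0"
    by (rule ge2.IH(1)) (use ge2.prems in simp)
  also have "b (Suc n) * (continuant b ?w 0 (Suc n) * x 1
        - c' 0 * inner_continuant b ?w (Suc n) * x 0)
      - ?w n * (continuant b ?w 0 n * x 1 - c' 0 * inner_continuant b ?w n * x 0)
      = continuant b ?w 0 (Suc (Suc n)) * x 1
        - c' 0 * inner_continuant b ?w (Suc (Suc n)) * x 0"
    unfolding inner_continuant_rec by (simp add: algebra_simps)
  finally show ?case .
qed

section \<open>Matchings of paths and cycles\<close>

text \<open>
  A matching is encoded by the set of the first endpoints of its edges; edge \<open>i\<close> joins \<open>i\<close> to \<open>i + 1\<close>, so two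
  edges are disjoint iff their numbers differ by at least 2. The path has the \<open>n\<close> vertices
  \<open>s, \<dots>, s + n - 1\<close>; in the cycle on \<open>0, \<dots>, p - 1\<close> the edge \<open>p - 1\<close> joins \<open>p - 1\<close> to \<open>0\<close>. For \<open>p = 1\<close> this
  edge would be a loop, and the condition on \<open>Suc i mod p\<close> excludes it.
\<close>

definition path_matchings :: "nat \<Rightarrow> nat \<Rightarrow> nat set set" where
  "path_matchings s n = {S. (\<forall>i\<in>S. s \<le> i \<and> Suc i < s + n) \<and> (\<forall>i\<in>S. Suc i \<notin> S)}"

definition cycle_matchings :: "nat \<Rightarrow> nat set set" where
  "cycle_matchings p = {S. S \<subseteq> {..<p} \<and> (\<forall>i\<in>S. Suc i mod p \<notin> S)}"

lemma finite_path_matchings [simp]: "finite (path_matchings s n)"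
  by (rule finite_subset[of _ "Pow {..<s + n}"]) (auto simp: path_matchings_def)

lemma finite_cycle_matchings [simp]: "finite (cycle_matchings p)"
  by (rule finite_subset[of _ "Pow {..<p}"]) (auto simp: cycle_matchings_def)

lemma finite_path_matching: "S \<in> path_matchings s n \<Longrightarrow> finite S"
  by (rule finite_subset[of _ "{..<s + n}"]) (auto simp: path_matchings_def)

text \<open>
  Here \<open>X\<close> is the vertex set and \<open>C\<close> the set of the vertices covered by the matching \<open>S\<close>. It is an argument of its
  own because the second endpoint of an edge depends on whether the graph is a path or a cycle.
\<close>

definition matching_weight ::
  "(nat \<Rightarrow> 'a::comm_ring_1) \<Rightarrow> (nat \<Rightarrow> 'a) \<Rightarrow> nat set \<Rightarrow> nat set \<Rightarrow> nat set \<Rightarrow> 'a" where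
  "matching_weight b w S C X = (\<Prod>i\<in>S. - w i) * (\<Prod>i\<in>X - C. b i)"

text \<open>
  Either the last vertex \<open>s + n + 1\<close> is unmatched, or it is matched by the edge \<open>s + n\<close>, and then the other edges
  form a matching of the path without its last two vertices. These are the two terms of the continuant
  recurrence.
\<close>

lemma path_matchings_Suc_Suc:
  "path_matchings s (Suc (Suc n)) =
     path_matchings s (Suc n) \<union> insert (s + n) ` path_matchings s n"
proof (intro equalityI subsetI)
  fix S assume S: "S \<in> path_matchings s (Suc (Suc n))"
  show "S \<in> path_matchings s (Suc n) \<union> insert (s + n) ` path_matchings s n"
  proof (cases "s + n \<in> S")
    case True
    have "s \<le> i \<and> Suc i < s + n" if "i \<in> S - {s + n}" for i
    proof -
      have "Suc i \<noteq> s + n" using that S True by (auto simp: path_matchings_def)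
      moreover have "s \<le> i" "Suc i < s + Suc (Suc n)"
        using that S unfolding path_matchings_def by blast+
      ultimately show ?thesis using that by auto
    qed
    then have "S - {s + n} \<in> path_matchings s n"
      using S by (auto simp: path_matchings_def)
    moreover have "S = insert (s + n) (S - {s + n})" using True by auto
    ultimately show ?thesis by blast
  next
    case False
    have "s \<le> i \<and> Suc i < s + Suc n" if "i \<in> S" for i
    proof -
      have "i \<noteq> s + n" using that False by auto
      moreover have "s \<le> i" "Suc i < s + Suc (Suc n)"
        using that S unfolding path_matchings_def by blast+
      ultimately show ?thesis by auto
    qed
    then show ?thesis using S by (auto simp: path_matchings_def)
  qed
next
  fix S assume "S \<in> path_matchings s (Suc n) \<union> insert (s + n) ` path_matchings s n"
  then show "S \<in> path_matchings s (Suc (Suc n))"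
    unfolding path_matchings_def by fastforce
qed

lemma continuant_eq_sum_matchings:
  "continuant b w s n =
     (\<Sum>S\<in>path_matchings s n. matching_weight b w S (S \<union> Suc ` S) {s..<s + n})"
proof (induction n rule: induct_nat_012)
  case 0
  have "path_matchings s 0 = {{}}" by (force simp: path_matchings_def)
  then show ?case by (simp add: matching_weight_def)
next
  case 1
  have "path_matchings s (Suc 0) = {{}}" by (force simp: path_matchings_def)
  then show ?case by (simp add: matching_weight_def)
next
  case (ge2 n)
  let ?wt = "\<lambda>n S. matching_weight b w S (S \<union> Suc ` S) {s..<s + n}"
  have mem: "i \<in> S \<Longrightarrow> s \<le> i \<and> Suc i < s + m" if "S \<in> path_matchings s m" for S m i
    using that by (auto simp: path_matchings_def)
  have disj: "path_matchings s (Suc n) \<inter> insert (s + n) ` path_matchings s n = {}"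
    using mem by fastforce
  have inj: "inj_on (insert (s + n)) (path_matchings s n)"
  proof (rule inj_onI)
    fix S T assume "S \<in> path_matchings s n" "T \<in> path_matchings s n"
      and eq: "insert (s + n) S = insert (s + n) T"
    then have "s + n \<notin> S" "s + n \<notin> T" using mem by fastforce+
    with eq show "S = T" by (simp add: insert_ident)
  qed
  have skip: "?wt (Suc (Suc n)) S = b (s + Suc n) * ?wt (Suc n) S"
    if S: "S \<in> path_matchings s (Suc n)" for S
  proof -
    have "s + Suc n \<notin> S \<union> Suc ` S" using mem[OF S] by fastforce
    then have "{s..<s + Suc (Suc n)} - (S \<union> Suc ` S)
        = insert (s + Suc n) ({s..<s + Suc n} - (S \<union> Suc ` S))" by auto
    then show ?thesis by (simp add: matching_weight_def algebra_simps)
  qed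
  have take: "?wt (Suc (Suc n)) (insert (s + n) S) = - w (s + n) * ?wt n S"
    if S: "S \<in> path_matchings s n" for S
  proof -
    have "s + n \<notin> S" using mem[OF S] by fastforce
    moreover have "{s..<s + Suc (Suc n)} - (insert (s + n) S \<union> Suc ` insert (s + n) S)
        = {s..<s + n} - (S \<union> Suc ` S)"
      by auto
    ultimately show ?thesis
      using finite_path_matching[OF S] unfolding matching_weight_def by simp
  qed
  have "(\<Sum>S\<in>path_matchings s (Suc (Suc n)). ?wt (Suc (Suc n)) S)
      = (\<Sum>S\<in>path_matchings s (Suc n). ?wt (Suc (Suc n)) S)
        + (\<Sum>S\<in>path_matchings s n. ?wt (Suc (Suc n)) (insert (s + n) S))"
    unfolding path_matchings_Suc_Suc
    by (subst sum.union_disjoint) (use disj inj in \<open>simp_all add: sum.reindex\<close>)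
  also have "(\<Sum>S\<in>path_matchings s (Suc n). ?wt (Suc (Suc n)) S)
      = b (s + Suc n) * (\<Sum>S\<in>path_matchings s (Suc n). ?wt (Suc n) S)"
    unfolding sum_distrib_left by (intro sum.cong refl skip)
  also have "(\<Sum>S\<in>path_matchings s n. ?wt (Suc (Suc n)) (insert (s + n) S))
      = - w (s + n) * (\<Sum>S\<in>path_matchings s n. ?wt n S)"
    unfolding sum_distrib_left by (intro sum.cong refl take)
  finally show ?case using ge2 by simp
qed

text \<open>
  Without the closing edge \<open>{n + 1, 0}\<close> a matching of the cycle is one of the path; with it, the other
  edges avoid both of its endpoints.
\<close>

lemma cycle_matchings_split:
  "cycle_matchings (Suc (Suc n)) =
     path_matchings 0 (Suc (Suc n)) \<union> insert (Suc n) ` path_matchings 1 n"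
proof (intro equalityI subsetI)
  fix S assume S: "S \<in> cycle_matchings (Suc (Suc n))"
  then have lt: "i < Suc (Suc n)" and nx: "Suc i mod Suc (Suc n) \<notin> S" if "i \<in> S" for i
    using that by (auto simp: cycle_matchings_def)
  have nxt: "Suc i \<notin> S" if "i \<in> S" for i
    using nx[OF that] lt[of "Suc i"] by (cases "Suc i < Suc (Suc n)") auto
  show "S \<in> path_matchings 0 (Suc (Suc n)) \<union> insert (Suc n) ` path_matchings 1 n"
  proof (cases "Suc n \<in> S")
    case True
    have "0 \<notin> S" using nx[OF True] by simp
    have "1 \<le> i \<and> Suc i < 1 + n" if "i \<in> S - {Suc n}" for i
    proof -
      have "i \<noteq> 0" using that \<open>0 \<notin> S\<close> by (metis DiffD1)
      moreover have "i \<noteq> n" using that True nxt by auto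
      ultimately show ?thesis using that lt[of i] by auto
    qed
    then have "S - {Suc n} \<in> path_matchings 1 n"
      using nxt by (auto simp: path_matchings_def)
    moreover have "S = insert (Suc n) (S - {Suc n})" using True by auto
    ultimately show ?thesis by blast
  next
    case False
    have "Suc i < Suc (Suc n)" if "i \<in> S" for i
      using that lt[of i] False by (cases "i = Suc n") auto
    then show ?thesis using nxt by (auto simp: path_matchings_def)
  qed
next
  fix S assume "S \<in> path_matchings 0 (Suc (Suc n)) \<union> insert (Suc n) ` path_matchings 1 n"
  then show "S \<in> cycle_matchings (Suc (Suc n))"
  proof
    assume "S \<in> path_matchings 0 (Suc (Suc n))"
    then show ?thesis by (auto simp: path_matchings_def cycle_matchings_def)
  next
    assume "S \<in> insert (Suc n) ` path_matchings 1 n"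
    then obtain T where T: "S = insert (Suc n) T" "T \<in> path_matchings 1 n" by blast
    then have m: "1 \<le> i \<and> i < n \<and> Suc i \<notin> T" if "i \<in> T" for i
      using that by (auto simp: path_matchings_def)
    have "0 \<notin> T" using m by fastforce
    then show ?thesis using m T(1) by (fastforce simp: cycle_matchings_def)
  qed
qed

text \<open>
  The closing edge gets its own weight \<open>e\<close>. The continuants in the result depend on \<open>w i\<close> only for
  \<open>i < p - 1\<close>, so \<open>e\<close> does not enter them.
\<close>

lemma sum_cycle_matchings:
  fixes b w :: "nat \<Rightarrow> 'a::comm_ring_1"
  assumes "p \<ge> 1"
  shows "(\<Sum>S\<in>cycle_matchings p. matching_weight b (w(p - 1 := e)) S
            (S \<union> (\<lambda>i. Suc i mod p) ` S) {..<p})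
       = continuant b w 0 p - e * inner_continuant b w (p - 1)"
proof (cases "p = 1")
  case True
  have "cycle_matchings (Suc 0) = {{}}" by (auto simp: cycle_matchings_def)
  then show ?thesis using True by (simp add: matching_weight_def)
next
  case False
  with assms obtain n where p: "p = Suc (Suc n)"
    by (metis One_nat_def not0_implies_Suc not_one_le_zero)
  let ?w = "w(p - 1 := e)"
  let ?wt = "\<lambda>S. matching_weight b ?w S (S \<union> (\<lambda>i. Suc i mod p) ` S) {..<p}"
  have mem: "i \<in> S \<Longrightarrow> s \<le> i \<and> Suc i < s + m" if "S \<in> path_matchings s m" for S s m i
    using that by (auto simp: path_matchings_def)
  have disj: "path_matchings 0 (Suc (Suc n)) \<inter> insert (Suc n) ` path_matchings 1 n = {}"
    using mem by fastforce
  have inj: "inj_on (insert (Suc n)) (path_matchings 1 n)"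
  proof (rule inj_onI)
    fix S T assume "S \<in> path_matchings 1 n" "T \<in> path_matchings 1 n"
      and eq: "insert (Suc n) S = insert (Suc n) T"
    then have "Suc n \<notin> S" "Suc n \<notin> T" using mem by fastforce+
    with eq show "S = T" by (simp add: insert_ident)
  qed
  have open_wt: "?wt S = matching_weight b w S (S \<union> Suc ` S) {0..<0 + p}"
    if S: "S \<in> path_matchings 0 p" for S
  proof -
    have "(\<lambda>i. Suc i mod p) ` S = Suc ` S"
      using mem[OF S] by (intro image_cong) auto
    moreover have "(\<Prod>i\<in>S. - ?w i) = (\<Prod>i\<in>S. - w i)"
      using mem[OF S] by (intro prod.cong) (auto simp: p)
    ultimately show ?thesis by (simp add: matching_weight_def lessThan_atLeast0)
  qed
  have closed_wt: "?wt (insert (Suc n) S)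
      = - e * matching_weight b w S (S \<union> Suc ` S) {1..<1 + n}"
    if S: "S \<in> path_matchings 1 n" for S
  proof -
    have notin: "Suc n \<notin> S" using mem[OF S] by fastforce
    have "(\<lambda>i. Suc i mod p) ` S = Suc ` S"
      using mem[OF S] by (intro image_cong refl mod_less) (fastforce simp: p)
    then have "(\<lambda>i. Suc i mod p) ` insert (Suc n) S = insert 0 (Suc ` S)"
      by (simp add: p)
    moreover have "{..<p} - (insert (Suc n) S \<union> insert 0 (Suc ` S))
        = {1..<1 + n} - (S \<union> Suc ` S)"
      unfolding p by auto
    moreover have "(\<Prod>i\<in>insert (Suc n) S. - ?w i) = - e * (\<Prod>i\<in>S. - w i)"
    proof -
      have "(\<Prod>i\<in>S. - ?w i) = (\<Prod>i\<in>S. - w i)"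
        using notin by (intro prod.cong) (auto simp: p)
      then show ?thesis using notin finite_path_matching[OF S] by (simp add: p)
    qed
    ultimately show ?thesis by (simp only: matching_weight_def mult.assoc)
  qed
  have "(\<Sum>S\<in>cycle_matchings p. ?wt S)
      = (\<Sum>S\<in>path_matchings 0 p. ?wt S)
        + (\<Sum>S\<in>path_matchings 1 n. ?wt (insert (Suc n) S))"
    unfolding p cycle_matchings_split
    by (subst sum.union_disjoint) (use disj inj in \<open>simp_all add: sum.reindex\<close>)
  also have "(\<Sum>S\<in>path_matchings 0 p. ?wt S) = continuant b w 0 p"
    unfolding continuant_eq_sum_matchings by (intro sum.cong refl open_wt)
  also have "(\<Sum>S\<in>path_matchings 1 n. ?wt (insert (Suc n) S)) = - e * continuant b w 1 n"
    unfolding continuant_eq_sum_matchings sum_distrib_left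
    by (intro sum.cong refl closed_wt)
  finally show ?thesis by (simp add: p fun_upd_def)
qed

section \<open>Multi-indices as matchings of the cycle\<close>

text \<open>
  Over the first endpoints of its edges a matching becomes a binary multi-index. The value outside \<open>{..<p}\<close> is
  \<open>undefined\<close>, as for the functions in \<open>binary_indices p\<close>.
\<close>

definition set_index :: "nat \<Rightarrow> nat set \<Rightarrow> nat \<Rightarrow> nat" where
  "set_index p S = (\<lambda>i\<in>{..<p}. if i \<in> S then 1 else 0)"

lemma set_index_support:
  "S \<subseteq> {..<p} \<Longrightarrow> {i. i < p \<and> set_index p S i = 1} = S"
  by (auto simp: set_index_def)

lemma ones_set_index: "S \<subseteq> {..<p} \<Longrightarrow> ones p (set_index p S) = sorted_list_of_set S"
  unfolding ones_def by (simp only: set_index_support)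

lemma index_order_set_index:
  assumes "S \<subseteq> {..<p}"
  shows "index_order p (set_index p S) = card S"
proof -
  have "index_order p (set_index p S) = (\<Sum>i<p. if i \<in> S then 1 else 0)"
    unfolding index_order_def by (intro sum.cong) (auto simp: set_index_def)
  also have "\<dots> = card ({..<p} \<inter> S)"
    by (simp add: sum.If_cases)
  finally show ?thesis using assms by (simp add: Int_absorb1)
qed

lemma binary_indices_eq_image: "binary_indices p = set_index p ` Pow {..<p}"
proof (intro equalityI subsetI)
  fix \<alpha> assume \<alpha>: "\<alpha> \<in> binary_indices p"
  have "\<alpha> = set_index p {i. i < p \<and> \<alpha> i = 1}"
  proof
    fix i
    have "i < p \<Longrightarrow> \<alpha> i = 0 \<or> \<alpha> i = 1" using \<alpha> by (auto simp: binary_indices_def)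
    moreover have "\<not> i < p \<Longrightarrow> \<alpha> i = undefined"
      using \<alpha> by (auto simp: binary_indices_def PiE_def extensional_def)
    ultimately show "\<alpha> i = set_index p {i. i < p \<and> \<alpha> i = 1} i"
      by (auto simp: set_index_def)
  qed
  then show "\<alpha> \<in> set_index p ` Pow {..<p}" by blast
qed (auto simp: binary_indices_def set_index_def PiE_iff extensional_def)

lemma inj_on_set_index: "inj_on (set_index p) (Pow {..<p})"
  by (rule inj_on_inverseI[where g = "\<lambda>\<alpha>. {i. i < p \<and> \<alpha> i = 1}"])
    (simp add: set_index_support del: One_nat_def)

text \<open>
  In an increasing list a gap of at least 2 between neighbours already separates all entries. Around the cycle one
  further pair has to be checked: the edge \<open>p - 1\<close> meets the edge \<open>0\<close>, and these can only be the last and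
  the first entry.
\<close>

lemma separated_list_iff_cycle_matching:
  assumes S: "S \<subseteq> {..<p}" and card: "card S \<ge> 2"
  defines "ys \<equiv> sorted_list_of_set S"
  shows "((\<forall>j. j + 1 < card S \<longrightarrow> ys ! j + 2 \<le> ys ! (j + 1)) \<and>
            (ys ! 0 = 0 \<longrightarrow> ys ! (card S - 1) \<le> p - 2))
         \<longleftrightarrow> S \<in> cycle_matchings p"
proof -
  have fin: "finite S" using S finite_subset by blast
  have len: "length ys = card S" and set: "set ys = S"
    using fin by (simp_all add: ys_def)
  have less: "ys ! i < ys ! j" if "i < j" "j < card S" for i j
    using sorted_wrt_nth_less[of "(<)" ys i j] that len by (simp add: ys_def)
  have le: "ys ! i \<le> ys ! j" if "i \<le> j" "j < card S" for i j
    using less[of i j] that by (cases "i = j") auto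
  have nth: "ys ! j \<in> S" if "j < card S" for j
    using that len set nth_mem by metis
  have ltp: "i < p" if "i \<in> S" for i using that S by auto
  show ?thesis
  proof
    assume sep: "(\<forall>j. j + 1 < card S \<longrightarrow> ys ! j + 2 \<le> ys ! (j + 1)) \<and>
            (ys ! 0 = 0 \<longrightarrow> ys ! (card S - 1) \<le> p - 2)"
    have "Suc i mod p \<notin> S" if iS: "i \<in> S" for i
    proof
      assume nxt: "Suc i mod p \<in> S"
      obtain j where j: "j < card S" "i = ys ! j" using iS set len by (metis in_set_conv_nth)
      obtain k where k: "k < card S" "Suc i mod p = ys ! k"
        using nxt set len by (metis in_set_conv_nth)
      show False
      proof (cases "Suc i < p")
        case True
        then have eq: "ys ! k = Suc (ys ! j)" using k j by simp
        have "j < k"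
        proof (rule ccontr)
          assume "\<not> j < k"
          then have "ys ! k \<le> ys ! j" using le j by simp
          then show False using eq by simp
        qed
        then have "ys ! j + 2 \<le> ys ! (j + 1)" "ys ! (j + 1) \<le> ys ! k"
          using sep k le[of "j + 1" k] by auto
        then show False using eq by simp
      next
        case False
        then have i: "Suc i = p" using ltp[OF iS] by simp
        then have "ys ! k = 0" using k by simp
        then have "ys ! 0 = 0" using le[of 0 k] k by simp
        then have "ys ! (card S - 1) \<le> p - 2" using sep by simp
        moreover have "i \<le> ys ! (card S - 1)" using le[of j "card S - 1"] j by simp
        moreover have "p \<ge> 2"
          using card card_mono[OF _ S] by simp
        ultimately show False using i by simp
      qed
    qed
    then show "S \<in> cycle_matchings p" using S by (simp add: cycle_matchings_def)
  next
    assume "S \<in> cycle_matchings p"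
    then have nxt: "Suc i mod p \<notin> S" if "i \<in> S" for i
      using that by (simp add: cycle_matchings_def)
    have "ys ! j + 2 \<le> ys ! (j + 1)" if j: "j + 1 < card S" for j
    proof -
      have "ys ! j < ys ! (j + 1)" using less j by simp
      moreover have "ys ! (j + 1) \<noteq> Suc (ys ! j)"
      proof
        assume eq: "ys ! (j + 1) = Suc (ys ! j)"
        then have "Suc (ys ! j) mod p = ys ! (j + 1)"
          using ltp[OF nth[OF j]] by simp
        then show False using nxt[of "ys ! j"] nth[OF j] nth[of j] j by simp
      qed
      ultimately show ?thesis by simp
    qed
    moreover have "ys ! (card S - 1) \<le> p - 2" if "ys ! 0 = 0"
    proof -
      have last: "ys ! (card S - 1) \<in> S" using nth card by simp
      have "0 \<in> S" using nth[of 0] card that by simp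
      then have "Suc (ys ! (card S - 1)) \<noteq> p" using nxt[OF last] by auto
      then show ?thesis using ltp[OF last] by simp
    qed
    ultimately show "(\<forall>j. j + 1 < card S \<longrightarrow> ys ! j + 2 \<le> ys ! (j + 1)) \<and>
            (ys ! 0 = 0 \<longrightarrow> ys ! (card S - 1) \<le> p - 2)" by blast
  qed
qed

text \<open>
  The first and the second endpoints are disjoint sets of the same size. Hence summing over \<open>j \<le> p div 2\<close>
  misses no matching.
\<close>

lemma card_cycle_matching_le:
  assumes "S \<in> cycle_matchings p"
  shows "card S \<le> p div 2"
proof (cases "p = 0")
  case True
  then show ?thesis using assms by (simp add: cycle_matchings_def)
next
  case False
  let ?f = "\<lambda>i. Suc i mod p"
  have S: "S \<subseteq> {..<p}" and disj: "S \<inter> ?f ` S = {}"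
    using assms by (auto simp: cycle_matchings_def)
  have fin: "finite S" using S finite_subset by blast
  have "inj_on ?f S"
  proof (rule inj_onI)
    fix i j assume "i \<in> S" "j \<in> S" "Suc i mod p = Suc j mod p"
    moreover have "i < p" "j < p" using \<open>i \<in> S\<close> \<open>j \<in> S\<close> S by auto
    ultimately show "i = j"
      by (cases "Suc i = p"; cases "Suc j = p") auto
  qed
  then have "2 * card S = card (S \<union> ?f ` S)"
    using fin disj by (simp add: card_Un_disjoint card_image)
  also have "\<dots> \<le> card {..<p}"
    using S False by (intro card_mono) auto
  finally show ?thesis by simp
qed

text \<open>
  The bound on \<open>m\<close> matters for \<open>m = 1\<close> and \<open>p = 1\<close>, where \<open>Lam p m\<close> contains the multi-index \<open>(1)\<close> although the
  cycle of length 1 has no edge.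
\<close>

lemma Lam_eq_image:
  assumes "m \<le> p div 2"
  shows "Lam p m = set_index p ` {S \<in> cycle_matchings p. card S = m}"
proof -
  have sub: "S \<subseteq> {..<p}" if "S \<in> cycle_matchings p" for S
    using that by (simp add: cycle_matchings_def)
  consider "m = 0" | "m = 1" | "m \<ge> 2" by linarith
  then show ?thesis
  proof cases
    case 1
    have "{S \<in> cycle_matchings p. card S = 0} = {{}}"
      using finite_subset[OF sub] by (auto simp: cycle_matchings_def)
    then show ?thesis using 1 by (simp add: Lam_def set_index_def)
  next
    case 2
    have "S \<in> cycle_matchings p" if S: "S \<subseteq> {..<p}" "card S = 1" for S
    proof -
      obtain i where "S = {i}" using S(2) by (auto simp: card_1_singleton_iff)
      moreover have "p \<ge> 2" using assms 2 by simp
      ultimately show ?thesis using S(1)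
        by (cases "Suc i = p") (auto simp: cycle_matchings_def)
    qed
    then have "{S \<in> cycle_matchings p. card S = m} = {S \<in> Pow {..<p}. card S = 1}"
      using sub 2 by auto
    then show ?thesis
      using 2 by (auto simp: Lam_def binary_indices_eq_image index_order_set_index)
  next
    case 3
    define Q where "Q \<alpha> \<longleftrightarrow> (\<forall>j. j + 1 < m \<longrightarrow> ones p \<alpha> ! j + 2 \<le> ones p \<alpha> ! (j + 1)) \<and>
            (ones p \<alpha> ! 0 = 0 \<longrightarrow> ones p \<alpha> ! (m - 1) \<le> p - 2)" for \<alpha>
    have Lam: "Lam p m = {\<alpha> \<in> binary_indices p. index_order p \<alpha> = m \<and> Q \<alpha>}"
      using 3 by (simp add: Lam_def Q_def)
    have Q: "Q (set_index p S) \<longleftrightarrow> S \<in> cycle_matchings p" if "S \<subseteq> {..<p}" "card S = m" for S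
      using separated_list_iff_cycle_matching[of S p] that 3
      by (simp only: Q_def ones_set_index)
    show ?thesis
      unfolding Lam binary_indices_eq_image
      using Q sub index_order_set_index by auto
  qed
qed

lemma sum_Lam_eq_sum_cycle_matchings:
  fixes f :: "nat \<Rightarrow> (nat \<Rightarrow> nat) \<Rightarrow> 'a::comm_monoid_add"
  shows "(\<Sum>j = 0..p div 2. \<Sum>\<alpha>\<in>Lam p j. f j \<alpha>)
       = (\<Sum>S\<in>cycle_matchings p. f (card S) (set_index p S))"
proof -
  have "(\<Sum>\<alpha>\<in>Lam p j. f j \<alpha>)
      = (\<Sum>S\<in>{S \<in> cycle_matchings p. card S = j}. f (card S) (set_index p S))"
    if "j \<in> {0..p div 2}" for j
  proof -
    have "inj_on (set_index p) {S \<in> cycle_matchings p. card S = j}"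
      by (rule inj_on_subset[OF inj_on_set_index]) (auto simp: cycle_matchings_def)
    then show ?thesis
      using that by (simp add: Lam_eq_image sum.reindex)
  qed
  then have "(\<Sum>j = 0..p div 2. \<Sum>\<alpha>\<in>Lam p j. f j \<alpha>)
      = (\<Sum>j = 0..p div 2. \<Sum>S\<in>{S \<in> cycle_matchings p. card S = j}. f (card S) (set_index p S))"
    by (rule sum.cong[OF refl])
  also have "\<dots> = (\<Sum>S\<in>cycle_matchings p. f (card S) (set_index p S))"
    by (rule sum.group) (auto simp: card_cycle_matching_le)
  finally show ?thesis .
qed

lemma multi_power_set_index:
  assumes "S \<subseteq> {..<p}"
  shows "multi_power p a (set_index p S) = (\<Prod>i\<in>S. a (int i))"
proof -
  have "multi_power p a (set_index p S) = (\<Prod>i<p. if i \<in> S then a (int i) else 1)"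
    unfolding multi_power_def by (intro prod.cong) (auto simp: set_index_def)
  also have "\<dots> = (\<Prod>i\<in>{..<p} \<inter> S. a (int i))"
    by (simp add: prod.If_cases)
  finally show ?thesis using assms by (simp add: Int_absorb1)
qed

lemma bar_set_index:
  assumes "S \<subseteq> {..<p}"
  shows "bar p (set_index p S) = set_index p ({..<p} - (S \<union> (\<lambda>i. Suc i mod p) ` S))"
proof -
  have "finite S" using assms finite_subset by blast
  then show ?thesis
    unfolding bar_def ones_set_index[OF assms] by (auto simp: set_index_def fun_eq_iff)
qed

lemma multi_power_full_index: "multi_power p a (full_index p) = (\<Prod>i<p. a (int i))"
  unfolding multi_power_def by (intro prod.cong) (auto simp: full_index_def)

text \<open>
  The sign, the powers of \<open>a\<close> and \<open>c\<close> and the power of \<open>r\<close> are distributed over the edges, so that every edge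
  \<open>i\<close> carries \<open>- a i * c i\<close>, divided by \<open>r\<close> if it is the closing edge.
\<close>

lemma multi_index_sum_eq_continuant:
  fixes a b c :: "int \<Rightarrow> 'a::real_normed_field"
  assumes "p \<ge> 1"
  shows "(\<Sum>j = 0..p div 2. (- 1) ^ j *
            (\<Sum>\<alpha> \<in> Lam p j. r powi (- int (\<alpha> (p - 1))) *
               multi_power p a \<alpha> * multi_power p b (bar p \<alpha>) * multi_power p c \<alpha>))
    = continuant (\<lambda>i. b (int i)) (\<lambda>i. a (int i) * c (int i)) 0 p
      - a (int (p - 1)) * (c (int (p - 1)) / r)
        * inner_continuant (\<lambda>i. b (int i)) (\<lambda>i. a (int i) * c (int i)) (p - 1)"
proof -
  let ?b = "\<lambda>i. b (int i)" and ?w = "\<lambda>i. a (int i) * c (int i)"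
  let ?e = "a (int (p - 1)) * (c (int (p - 1)) / r)"
  let ?C = "\<lambda>S. S \<union> (\<lambda>i. Suc i mod p) ` S"
  have term_eq: "(- 1) ^ card S * (r powi (- int (set_index p S (p - 1))) *
        multi_power p a (set_index p S) * multi_power p b (bar p (set_index p S)) *
        multi_power p c (set_index p S))
      = matching_weight ?b (?w(p - 1 := ?e)) S (?C S) {..<p}"
    if "S \<in> cycle_matchings p" for S
  proof -
    have S: "S \<subseteq> {..<p}" using that by (simp add: cycle_matchings_def)
    then have fin: "finite S" using finite_subset by blast
    have "(\<Prod>i\<in>S. - (?w(p - 1 := ?e)) i)
        = (\<Prod>i\<in>S. (- 1) * a (int i) * c (int i) * (if i = p - 1 then inverse r else 1))"
      by (intro prod.cong) (auto simp: field_simps)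
    also have "\<dots> = (- 1) ^ card S * (\<Prod>i\<in>S. a (int i)) * (\<Prod>i\<in>S. c (int i))
          * (\<Prod>i\<in>S. if i = p - 1 then inverse r else 1)"
      by (simp add: prod.distrib prod_uminus)
    also have "(\<Prod>i\<in>S. if i = p - 1 then inverse r else 1)
        = r powi (- int (set_index p S (p - 1)))"
      using fin assms by (simp add: prod.delta set_index_def power_int_minus)
    finally show ?thesis
      by (simp add: matching_weight_def bar_set_index[OF S] multi_power_set_index S)
  qed
  have "(\<Sum>j = 0..p div 2. (- 1) ^ j *
            (\<Sum>\<alpha> \<in> Lam p j. r powi (- int (\<alpha> (p - 1))) *
               multi_power p a \<alpha> * multi_power p b (bar p \<alpha>) * multi_power p c \<alpha>))
      = (\<Sum>S\<in>cycle_matchings p. matching_weight ?b (?w(p - 1 := ?e)) S (?C S) {..<p})"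
    unfolding sum_distrib_left sum_Lam_eq_sum_cycle_matchings
    by (intro sum.cong refl term_eq)
  then show ?thesis by (simp only: sum_cycle_matchings[OF assms])
qed

section \<open>Quasi-periodic solutions\<close>

lemma two_by_two_kernel:
  fixes A B C D :: "'a::field"
  shows "(\<exists>x y. (x \<noteq> 0 \<or> y \<noteq> 0) \<and> A * x + B * y = 0 \<and> C * x + D * y = 0)
     \<longleftrightarrow> A * D - B * C = 0"
proof
  assume "\<exists>x y. (x \<noteq> 0 \<or> y \<noteq> 0) \<and> A * x + B * y = 0 \<and> C * x + D * y = 0"
  then obtain x y where xy: "x \<noteq> 0 \<or> y \<noteq> 0" "A * x + B * y = 0" "C * x + D * y = 0" by blast
  have "(A * D - B * C) * x = D * (A * x + B * y) - B * (C * x + D * y)"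
    and "(A * D - B * C) * y = A * (C * x + D * y) - C * (A * x + B * y)"
    by (simp_all add: algebra_simps)
  then show "A * D - B * C = 0" using xy by auto
next
  assume det: "A * D - B * C = 0"
  show "\<exists>x y. (x \<noteq> 0 \<or> y \<noteq> 0) \<and> A * x + B * y = 0 \<and> C * x + D * y = 0"
  proof (cases "A = 0 \<and> B = 0")
    case True
    show ?thesis
    proof (cases "C = 0 \<and> D = 0")
      case True
      then show ?thesis using \<open>A = 0 \<and> B = 0\<close> by (intro exI[of _ 1]) auto
    next
      case False
      \<comment> \<open>One equation is void, and \<open>(D, - C)\<close> spans the kernel of the other.\<close>
      then show ?thesis using True by (intro exI[of _ D] exI[of _ "- C"]) auto
    qed
  next
    case False
    then show ?thesis using det by (intro exI[of _ B] exI[of _ "- A"]) (auto simp: algebra_simps)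
  qed
qed

text \<open>
  In the converse direction, one period of \<open>x\<close> is continued quasi-periodically to all integers. The two boundary
  conditions say that the continuation still agrees with \<open>x\<close>, up to the power of \<open>rh\<close>, one step before and
  one step after the period. Each equation involves three neighbours, so it then holds across the seams too.
\<close>

lemma qp_solution_iff_boundary:
  fixes a b c :: "int \<Rightarrow> 'a::real_normed_field"
  assumes p: "p \<ge> 1" and r: "r \<noteq> 0" and rh: "rh \<noteq> 0"
    and a: "a \<in> qp_seqs_nz p r" and c: "c \<in> qp_seqs_nz p r" and b: "b \<in> qp_seqs p r"
  shows "(\<exists>z \<in> qp_seqs p rh. z \<noteq> (\<lambda>_. 0) \<and>
            (\<forall>k. a k * z (k + 1) - b k * z k + c (k - 1) * z (k - 1) = 0))
     \<longleftrightarrow> (\<exists>x. (x 0 \<noteq> 0 \<or> x 1 \<noteq> 0) \<and> x p = rh * x 0 \<and> x (Suc p) = rh * x 1 \<and>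
            (\<forall>n. a (int n) * x (Suc (Suc n))
               = b (int n) * x (Suc n) - c (int n - 1) * x n))"
    (is "(\<exists>z \<in> _. ?sol z) \<longleftrightarrow> (\<exists>x. ?bd x)")
proof
  assume "\<exists>z \<in> qp_seqs p rh. ?sol z"
  then obtain z where z: "z \<in> qp_seqs p rh" and nz: "z \<noteq> (\<lambda>_. 0)"
    and eq: "\<And>k. a k * z (k + 1) - b k * z k + c (k - 1) * z (k - 1) = 0" by blast
  define x where "x n = z (int n - 1)" for n
  have rec: "a (int n) * x (Suc (Suc n)) = b (int n) * x (Suc n) - c (int n - 1) * x n" for n
    using eq[of "int n"] by (simp add: x_def algebra_simps)
  have zp: "z (k + int p) = rh * z k" for k using z by (simp add: qp_seqs_def)
  have "x p = rh * x 0" "x (Suc p) = rh * x 1"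
    using zp[of "-1"] zp[of 0] by (simp_all add: x_def algebra_simps)
  moreover have "x 0 \<noteq> 0 \<or> x 1 \<noteq> 0"
  proof (rule ccontr)
    assume "\<not> (x 0 \<noteq> 0 \<or> x 1 \<noteq> 0)"
    then have x01: "x 0 = 0" "x (Suc 0) = 0" by simp_all
    have x0: "x n = 0" for n
    proof (induction n rule: induct_nat_012)
      case (ge2 n)
      then show ?case using rec[of n] a by (auto simp: qp_seqs_nz_def)
    qed (use x01 in simp_all)
    have "z k = 0" for k
    proof -
      have "z (k mod int p) = x (Suc (nat (k mod int p)))" using p by (simp add: x_def)
      then have "z (k mod int p + k div int p * int p) = 0"
        unfolding qp_seqs_shift[OF z rh] by (simp add: x0)
      then show ?thesis by (simp only: mod_div_mult_eq)
    qed
    then show False using nz by auto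
  qed
  ultimately show "\<exists>x. ?bd x" using rec by blast
next
  assume "\<exists>x. ?bd x"
  then obtain x where nz: "x 0 \<noteq> 0 \<or> x 1 \<noteq> 0" and xp: "x p = rh * x 0" "x (Suc p) = rh * x 1"
    and rec: "\<And>n. a (int n) * x (Suc (Suc n)) = b (int n) * x (Suc n) - c (int n - 1) * x n"
    by blast
  \<comment> \<open>The indices of \<open>x\<close> are shifted by one, so a period starting at 0 is read off from \<open>x 1, \<dots>, x p\<close>.\<close>
  define z where "z k = rh powi (k div int p) * x (Suc (nat (k mod int p)))" for k
  have z_at: "z (int i + q * int p) = rh powi q * x (Suc i)" if "i < p" for i q
    using that by (simp add: z_def)
  have ext: "z (int n - 1 + q * int p) = rh powi q * x n" if n: "n \<le> Suc p" for n q
  proof -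
    have "n = 0 \<or> (\<exists>i. n = Suc i \<and> i < p) \<or> n = Suc p"
      using n by (cases n) auto
    then consider "n = 0" | i where "n = Suc i" "i < p" | "n = Suc p" by blast
    then show ?thesis
    proof cases
      case 1
      have "int n - 1 + q * int p = int (p - 1) + (q - 1) * int p"
        using 1 p by (simp add: algebra_simps of_nat_diff)
      then have "z (int n - 1 + q * int p) = rh powi (q - 1) * x (Suc (p - 1))"
        using z_at[of "p - 1" "q - 1"] p by (simp only:)
      also have "x (Suc (p - 1)) = rh * x n"
        using p 1 xp(1) by simp
      finally show ?thesis
        using rh by (simp add: power_int_diff)
    next
      case (2 i)
      then show ?thesis using z_at[of i q] by simp
    next
      case 3
      have "int n - 1 + q * int p = int 0 + (q + 1) * int p"
        using 3 by (simp add: algebra_simps)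
      then have "z (int n - 1 + q * int p) = rh powi (q + 1) * x 1"
        using z_at[of 0 "q + 1"] p by simp
      then show ?thesis
        using rh 3 xp(2) by (simp add: power_int_add)
    qed
  qed
  have "z \<in> qp_seqs p rh"
    using p rh by (simp add: qp_seqs_def z_def power_int_add)
  moreover have "z \<noteq> (\<lambda>_. 0)"
    using ext[of 0 0] ext[of 1 0] nz by auto
  moreover have "a k * z (k + 1) - b k * z k + c (k - 1) * z (k - 1) = 0" for k
  proof -
    define q i where "q = k div int p" and "i = nat (k mod int p)"
    have k: "k = int i + q * int p" using p by (simp add: q_def i_def)
    have "i < p" using p by (simp add: i_def nat_less_iff)
    have zs: "z (k + 1) = rh powi q * x (Suc (Suc i))" "z k = rh powi q * x (Suc i)"
      "z (k - 1) = rh powi q * x i"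
      using ext[of "Suc (Suc i)" q] ext[of "Suc i" q] ext[of i q] \<open>i < p\<close>
      by (simp_all add: k algebra_simps)
    have coeffs: "a k = r powi q * a (int i)" "b k = r powi q * b (int i)"
      "c (k - 1) = r powi q * c (int i - 1)"
      using qp_seqs_shift[of a p r "int i" q] qp_seqs_shift[of b p r "int i" q]
        qp_seqs_shift[of c p r "int i - 1" q] a b c r
      by (simp_all add: k qp_seqs_nz_def algebra_simps)
    have "a k * z (k + 1) - b k * z k + c (k - 1) * z (k - 1)
        = r powi q * rh powi q * (a (int i) * x (Suc (Suc i)) - b (int i) * x (Suc i)
            + c (int i - 1) * x i)"
      unfolding zs coeffs by (simp add: algebra_simps)
    then show ?thesis by (simp add: rec)
  qed
  ultimately show "\<exists>z \<in> qp_seqs p rh. ?sol z" by blast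
qed

lemma ex_recurrence_solution:
  fixes a b c' :: "nat \<Rightarrow> 'a::field"
  assumes "\<And>n. a n \<noteq> 0"
  shows "\<exists>x. x 0 = u \<and> x 1 = v \<and> (\<forall>n. a n * x (Suc (Suc n)) = b n * x (Suc n) - c' n * x n)"
proof -
  define st where
    "st = rec_nat (u, v) (\<lambda>n (s, t). (t, (b n * t - c' n * s) / a n))"
  have "st (Suc n) = (snd (st n), (b n * snd (st n) - c' n * fst (st n)) / a n)" for n
    by (simp add: st_def case_prod_unfold)
  then show ?thesis
    using assms by (intro exI[of _ "\<lambda>n. fst (st n)"]) (simp add: st_def)
qed

theorem theorem4p7:
  fixes p :: nat and r rh :: "'a::real_normed_field" and a b c :: "int \<Rightarrow> 'a"
  assumes "p \<ge> 1" and "r \<noteq> 0" and "rh \<noteq> 0"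
    and "a \<in> qp_seqs_nz p r" and "c \<in> qp_seqs_nz p r" and "b \<in> qp_seqs p r"
  shows "(\<exists>z \<in> qp_seqs p rh. z \<noteq> (\<lambda>_. 0) \<and>
            (\<forall>k. a k * z (k + 1) - b k * z k + c (k - 1) * z (k - 1) = 0))
    \<longleftrightarrow> rh * multi_power p a (full_index p) + inverse (r * rh) * multi_power p c (full_index p)
       = (\<Sum>j = 0..p div 2. (- 1) ^ j *
            (\<Sum>\<alpha> \<in> Lam p j. r powi (- int (\<alpha> (p - 1))) *
               multi_power p a \<alpha> * multi_power p b (bar p \<alpha>) * multi_power p c \<alpha>))"
proof -
  let ?a = "\<lambda>n. a (int n)" and ?b = "\<lambda>n. b (int n)" and ?c = "\<lambda>n. c (int n - 1)"
  let ?w = "\<lambda>i. a (int i) * c (int i)"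
  let ?\<gamma> = "c (- 1)"
  let ?U = "continuant ?b ?w 0" and ?V = "inner_continuant ?b ?w"
  define A where "A n = (\<Prod>j<n. a (int j))" for n
  define W where "W n = (\<Prod>j<n. c (int j))" for n
  obtain m where m: "p = Suc m" using assms(1) by (cases p) auto
  have a0: "a k \<noteq> 0" for k using assms(4) by (simp add: qp_seqs_nz_def)
  have A0: "A n \<noteq> 0" for n by (simp add: A_def a0)
  have AS: "A (Suc n) = a (int n) * A n" for n by (simp add: A_def mult.commute)
  have \<gamma>: "c (int m) = r * ?\<gamma>"
  proof -
    have "c (k + int p) = r * c k" for k
      using assms(5) by (simp add: qp_seqs_nz_def qp_seqs_def)
    from this[of "- 1"] show ?thesis by (simp add: m)
  qed
  have WS: "W p = r * ?\<gamma> * W m" by (simp add: W_def m \<gamma> mult.commute)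
  have cas: "?U m * ?V p - ?U p * ?V m = A m * W m"
    using continuant_casoratian[of ?b ?w m] by (simp add: m A_def W_def prod.distrib)
  have closed: "A n * x (Suc n) = ?U n * x 1 - ?\<gamma> * ?V n * x 0"
    if rec: "\<forall>n. ?a n * x (Suc (Suc n)) = ?b n * x (Suc n) - ?c n * x n" for n x
    using recurrence_solution_continuant[of n ?a x ?b ?c n] rec by (simp add: A_def)
  \<comment> \<open>The two boundary conditions, multiplied by \<open>A p\<close> and \<open>A m\<close>, as linear equations for \<open>(s, t) = (x 0, x 1)\<close>.\<close>
  let ?lin = "\<lambda>s t. (- ?\<gamma> * ?V p) * s + (?U p - rh * A p) * t = 0 \<and>
      (- (?\<gamma> * ?V m + rh * A m)) * s + ?U m * t = 0"
  have bd: "x p = rh * x 0 \<and> x (Suc p) = rh * x 1 \<longleftrightarrow> ?lin (x 0) (x 1)"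
    if rec: "\<forall>n. ?a n * x (Suc (Suc n)) = ?b n * x (Suc n) - ?c n * x n" for x
  proof -
    have "x p = rh * x 0 \<longleftrightarrow> A m * x p = A m * (rh * x 0)"
      and "x (Suc p) = rh * x 1 \<longleftrightarrow> A p * x (Suc p) = A p * (rh * x 1)"
      using A0 by simp_all
    moreover have "A m * x p = ?U m * x 1 - ?\<gamma> * ?V m * x 0"
      using closed[OF rec, of m] by (simp only: m)
    moreover note closed[OF rec, of p]
    ultimately show ?thesis by (auto simp: algebra_simps)
  qed
  have "(\<exists>z \<in> qp_seqs p rh. z \<noteq> (\<lambda>_. 0) \<and>
            (\<forall>k. a k * z (k + 1) - b k * z k + c (k - 1) * z (k - 1) = 0))
      \<longleftrightarrow> (\<exists>x. (x 0 \<noteq> 0 \<or> x 1 \<noteq> 0) \<and> ?lin (x 0) (x 1) \<and>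
            (\<forall>n. ?a n * x (Suc (Suc n)) = ?b n * x (Suc n) - ?c n * x n))"
    unfolding qp_solution_iff_boundary[OF assms] using bd by blast
  also have "\<dots> \<longleftrightarrow> (\<exists>s t. (s \<noteq> 0 \<or> t \<noteq> 0) \<and> ?lin s t)"
  proof
    assume "\<exists>s t. (s \<noteq> 0 \<or> t \<noteq> 0) \<and> ?lin s t"
    then obtain s t where st: "s \<noteq> 0 \<or> t \<noteq> 0" "?lin s t" by blast
    obtain x where "x 0 = s" "x 1 = t"
      "\<forall>n. ?a n * x (Suc (Suc n)) = ?b n * x (Suc n) - ?c n * x n"
      using ex_recurrence_solution[of ?a s t ?b ?c] a0 by blast
    with st show "\<exists>x. (x 0 \<noteq> 0 \<or> x 1 \<noteq> 0) \<and> ?lin (x 0) (x 1) \<and>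
            (\<forall>n. ?a n * x (Suc (Suc n)) = ?b n * x (Suc n) - ?c n * x n)" by blast
  qed blast
  also have "\<dots> \<longleftrightarrow> (- ?\<gamma> * ?V p) * ?U m - (?U p - rh * A p) * (- (?\<gamma> * ?V m + rh * A m)) = 0"
    by (rule two_by_two_kernel)
  also have "(- ?\<gamma> * ?V p) * ?U m - (?U p - rh * A p) * (- (?\<gamma> * ?V m + rh * A m))
      = rh * A m * (?U p - a (int m) * ?\<gamma> * ?V m) - rh * A m * (rh * A p)
        - ?\<gamma> * (?U m * ?V p - ?U p * ?V m)"
    unfolding m AS by (simp add: algebra_simps del: continuant.simps inner_continuant_simps)
  \<comment> \<open>The Casoratian turns the last summand into a product of values of \<open>a\<close> and \<open>c\<close>, and \<open>rh * A m\<close> splits off.\<close>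
  also have "\<dots> = rh * A m *
      ((?U p - a (int m) * ?\<gamma> * ?V m) - (rh * A p + inverse (r * rh) * W p))"
    unfolding cas WS using assms(2,3)
    by (simp add: field_simps del: continuant.simps inner_continuant_simps)
  also have "\<dots> = 0 \<longleftrightarrow> rh * A p + inverse (r * rh) * W p = ?U p - a (int m) * ?\<gamma> * ?V m"
    using A0 assms(3) by auto
  also have "?\<gamma> = c (int m) / r" using \<gamma> assms(2) by simp
  finally show ?thesis
    unfolding multi_index_sum_eq_continuant[OF assms(1)] multi_power_full_index
    by (simp add: A_def W_def m del: continuant.simps inner_continuant_simps)
qed

end
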